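(* Let $\mathbf a_{\mathrm{Id}}=\{\Delta_1,\dots,\Delta_n\}$ be a symmetric multisegment such that $b(\Delta_1)<\cdots<b(\Delta_n)$ and $e(\Delta_1)<\cdots<e(\Delta_n)$. Then the formula $$\Phi(w)=\sum_{i=1}^n[b(\Delta_i),e(\Delta_{w(i)})],\qquad w\in S_n,$$ defines a bijection between $S_n$ and $S(\mathbf a_{\mathrm{Id}})$. Moreover, the order relation on $S(\mathbf a_{\mathrm{Id}})$ induces the inverse Bruhat order: $w\le v\Leftrightarrow\Phi(w)\ge\Phi(v)$.
   Context: A segment is $\Delta=[i,j]=\{i,\dots,j\}$ with integers $i\le j$; $b(\Delta)=i$, $e(\Delta)=j$. A multisegment is a finite multiset of segments, also written as a formal sum. Two segments are linked if neither contains the other and their union is a segment. An elementary operation on a multisegment replaces a linked pair $\{\Delta,\Delta'\}$ by $\{\Delta\cup\Delta',\Delta\cap\Delta'\}$ (discarding empty segments). Write $\mathbf b\le\mathbf a$ if $\mathbf b$ is obtained from $\mathbf a$ by a (possibly empty) series of elementary operations; $S(\mathbf a)=\{\mathbf b:\mathbf b\le\mathbf a\}$. A multisegment is ordinary if no two of its segments have the same beginning or the same end. An ordinary multisegment $\{\Delta_1,\dots,\Delta_n\}$ is symmetric if $\max_i b(\Delta_i)\le\min_i e(\Delta_i)$. $S_n$ carries the Bruhat order $\le$. *)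

theory Defs
  imports Main "HOL-Library.Multiset" "HOL-Combinatorics.Permutations"
begin

definition is_segment :: "int set \<Rightarrow> bool" where
  "is_segment D \<longleftrightarrow> (\<exists>i j. i \<le> j \<and> D = {i..j})"

definition seg_begin :: "int set \<Rightarrow> int" where
  "seg_begin D = Min D"

definition seg_end :: "int set \<Rightarrow> int" where
  "seg_end D = Max D"

definition multisegment :: "int set multiset \<Rightarrow> bool" where
  "multisegment a \<longleftrightarrow> (\<forall>D\<in>#a. is_segment D)"

definition linked :: "int set \<Rightarrow> int set \<Rightarrow> bool" where
  "linked D D' \<longleftrightarrow> is_segment D \<and> is_segment D' \<and>
     \<not> D \<subseteq> D' \<and> \<not> D' \<subseteq> D \<and> is_segment (D \<union> D')"

definition elementary_op :: "int set multiset \<Rightarrow> int set multiset \<Rightarrow> bool" where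
  "elementary_op a a' \<longleftrightarrow> (\<exists>D D'. {#D, D'#} \<subseteq># a \<and> linked D D' \<and>
     a' = (a - {#D, D'#}) + filter_mset (\<lambda>E. E \<noteq> {}) {#D \<union> D', D \<inter> D'#})"

definition mseg_le :: "int set multiset \<Rightarrow> int set multiset \<Rightarrow> bool" where
  "mseg_le b a \<longleftrightarrow> elementary_op\<^sup>*\<^sup>* a b"

definition mseg_below :: "int set multiset \<Rightarrow> int set multiset set" where
  "mseg_below a = {b. mseg_le b a}"

text \<open>Beginnings and ends are counted with multiplicity, so an ordinary multisegment
  has no repeated segments.\<close>

definition ordinary :: "int set multiset \<Rightarrow> bool" where
  "ordinary a \<longleftrightarrow> multisegment a \<and>
     (\<forall>x. count (image_mset seg_begin a) x \<le> 1) \<and>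
     (\<forall>x. count (image_mset seg_end a) x \<le> 1)"

definition symmetric :: "int set multiset \<Rightarrow> bool" where
  "symmetric a \<longleftrightarrow> ordinary a \<and>
     Max (seg_begin ` set_mset a) \<le> Min (seg_end ` set_mset a)"

text \<open>The symmetric group on \<open>n\<close> letters is the set of \<open>w\<close> with \<open>w permutes {1..n}\<close>, with
  composition of functions as product. Its Coxeter generators are the adjacent transpositions.\<close>

definition simple_transpositions :: "nat \<Rightarrow> (nat \<Rightarrow> nat) set" where
  "simple_transpositions n = {transpose i (Suc i) | i. 1 \<le> i \<and> i < n}"

definition coxeter_length :: "nat \<Rightarrow> (nat \<Rightarrow> nat) \<Rightarrow> nat" where
  "coxeter_length n w =
     (LEAST k. \<exists>ws. length ws = k \<and> set ws \<subseteq> simple_transpositions n \<and> w = foldr (\<circ>) ws id)"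

text \<open>Multiplying by reflections on the left instead of the right gives the same relation,
  since the set of transpositions is closed under conjugation.\<close>

definition bruhat_step :: "nat \<Rightarrow> (nat \<Rightarrow> nat) \<Rightarrow> (nat \<Rightarrow> nat) \<Rightarrow> bool" where
  "bruhat_step n u v \<longleftrightarrow> u permutes {1..n} \<and>
     (\<exists>i j. 1 \<le> i \<and> i < j \<and> j \<le> n \<and> v = u \<circ> transpose i j) \<and>
     coxeter_length n u < coxeter_length n v"

definition bruhat_le :: "nat \<Rightarrow> (nat \<Rightarrow> nat) \<Rightarrow> (nat \<Rightarrow> nat) \<Rightarrow> bool" where
  "bruhat_le n = (bruhat_step n)\<^sup>*\<^sup>*"

definition Phi :: "nat \<Rightarrow> (nat \<Rightarrow> int set) \<Rightarrow> (nat \<Rightarrow> nat) \<Rightarrow> int set multiset" where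
  "Phi n \<Delta> w = (\<Sum>i=1..n. {# {seg_begin (\<Delta> i)..seg_end (\<Delta> (w i))} #})"

end

theory Submission
  imports Defs
begin

text \<open>
  Write \<open>b i\<close> and \<open>e i\<close> for the beginning and the end of \<open>\<Delta> i\<close>. Symmetry says that every
  \<open>b i\<close> is at most every \<open>e j\<close>, so that all the intervals \<open>[b i, e j]\<close> are nonempty and any two
  of them meet. For \<open>i < j\<close> the segments \<open>[b i, e (w i)]\<close> and \<open>[b j, e (w j)]\<close> are therefore linked
  exactly when \<open>w i < w j\<close>, and the elementary operation exchanges their ends: it turns \<open>Phi w\<close>
  into \<open>Phi (w \<circ> transpose i j)\<close>. On the other side, the Coxeter length of a permutation is its
  number of inversions, and this number grows under \<open>w \<mapsto> w \<circ> transpose i j\<close> exactly when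
  \<open>w i < w j\<close>. Hence elementary operations on \<open>Phi w\<close> are the same as Bruhat steps from \<open>w\<close>
  (lemma \<open>elementary_op_Phi_iff\<close>).

  The beginnings are distinct and so are the ends, hence \<open>Phi\<close> is injective and the reflexive
  transitive closures of the two relations correspond. In particular the multisegments below
  \<open>Phi id\<close>, which is the given multisegment, are the \<open>Phi w\<close> with \<open>w\<close> above the identity in the
  Bruhat order. Every permutation is above the identity, because it can be sorted by adjacent
  transpositions that remove inversions (lemma \<open>bruhat_le_id\<close>); this gives surjectivity.
\<close>

section \<open>Coxeter length and inversions\<close>

text \<open>The inversions of a permutation, recorded by positions.\<close>

definition inversions :: "nat \<Rightarrow> (nat \<Rightarrow> nat) \<Rightarrow> (nat \<times> nat) set" where
  "inversions n w = {(a, b). 1 \<le> a \<and> a < b \<and> b \<le> n \<and> w b < w a}"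

lemma finite_inversions [simp]: "finite (inversions n w)"
  by (rule finite_subset [of _ "{1..n} \<times> {1..n}"]) (auto simp: inversions_def)

text \<open>The injection behind the following inequality moves an inversion \<open>(a, b)\<close> of \<open>w\<close> along
  the transposition whenever this preserves the order of the two positions, and leaves it alone
  otherwise; the pair \<open>(i, j)\<close> is an inversion of the composite that it misses.\<close>

lemma card_inversions_less_transpose:
  assumes "1 \<le> i" "i < j" "j \<le> n" and lt: "w i < w j"
  shows "card (inversions n w) < card (inversions n (w \<circ> transpose i j))"
proof -
  let ?t = "transpose i j"
  define f where "f = (\<lambda>(a, b). if ?t a < ?t b then (?t a, ?t b) else (a, b))"
  have "inj_on f (inversions n w)"
  proof (rule inj_onI, clarify)
    fix a b c d
    assume "(a, b) \<in> inversions n w" "(c, d) \<in> inversions n w" "f (a, b) = f (c, d)"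
    then show "a = c \<and> b = d"
      by (auto simp: f_def inversions_def split: if_splits dest!: injD [OF inj_transpose])
  qed
  moreover have "f ` inversions n w \<subseteq> inversions n (w \<circ> ?t) - {(i, j)}"
  proof (rule image_subsetI)
    fix p assume "p \<in> inversions n w"
    then show "f p \<in> inversions n (w \<circ> ?t) - {(i, j)}"
      using assms by (auto simp: f_def inversions_def transpose_def split: if_splits)
  qed
  ultimately have "card (inversions n w) \<le> card (inversions n (w \<circ> ?t) - {(i, j)})"
    by (intro card_inj_on_le) auto
  also have "\<dots> < card (inversions n (w \<circ> ?t))"
    using assms by (intro card_Diff1_less [OF finite_inversions]) (auto simp: inversions_def)
  finally show ?thesis .
qed

lemma card_inversions_adjacent_le:
  assumes "1 \<le> k" "k < n"
  shows "card (inversions n (w \<circ> transpose k (Suc k))) \<le> Suc (card (inversions n w))"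
proof -
  let ?t = "transpose k (Suc k)"
  let ?I = "inversions n (w \<circ> ?t)"
  have "card (?I - {(k, Suc k)}) \<le> card (inversions n w)"
  proof (rule card_inj_on_le [of "map_prod ?t ?t"])
    show "inj_on (map_prod ?t ?t) (?I - {(k, Suc k)})"
      by (rule inj_on_subset [OF prod.inj_map]) auto
    show "map_prod ?t ?t ` (?I - {(k, Suc k)}) \<subseteq> inversions n w"
      using assms by (auto simp: inversions_def transpose_def split: if_splits)
  qed auto
  moreover have "card ?I \<le> Suc (card (?I - {(k, Suc k)}))"
    by (metis card.infinite card_Suc_Diff1 card_Diff_singleton_if le_SucI order_refl zero_le)
  ultimately show ?thesis by linarith
qed

lemma foldr_comp_snoc: "foldr (\<circ>) (ws @ [s]) id = foldr (\<circ>) ws id \<circ> s"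
  by (induction ws) (auto simp: comp_assoc)

lemma card_inversions_word_le:
  assumes "set ws \<subseteq> simple_transpositions n"
  shows "card (inversions n (foldr (\<circ>) ws id)) \<le> length ws"
  using assms
proof (induction ws rule: rev_induct)
  case Nil
  have "inversions n id = {}" by (auto simp: inversions_def)
  then show ?case by (simp add: id_def)
next
  case (snoc s ws)
  from snoc.prems obtain k where k: "s = transpose k (Suc k)" "1 \<le> k" "k < n"
    by (auto simp: simple_transpositions_def)
  have "card (inversions n (foldr (\<circ>) ws id)) \<le> length ws"
    using snoc.prems by (intro snoc.IH) simp
  with card_inversions_adjacent_le [OF k(2,3), of "foldr (\<circ>) ws id"] show ?case
    unfolding foldr_comp_snoc k(1) length_append_singleton by linarith
qed

lemma permutes_increasing_eq_id:
  assumes w: "w permutes {1..n::nat}"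
    and inc: "\<And>k. 1 \<le> k \<Longrightarrow> k < n \<Longrightarrow> w k < w (Suc k)"
  shows "w = id"
proof -
  have low: "k \<le> w k" if "1 \<le> k" "k \<le> n" for k
    using that(1,2)
  proof (induction k rule: nat_induct_at_least)
    case base
    then show ?case using permutes_in_image [OF w, of 1] by simp
  next
    case (Suc k)
    then show ?case using inc [of k] by simp
  qed
  have "k \<le> w k" for k
    using low [of k] permutes_not_in [OF w, of k] by (cases "k \<in> {1..n}") auto
  then show ?thesis
    using permutes_natset_ge [OF w] by blast
qed

text \<open>A permutation other than the identity has a descent at some position \<open>k\<close>; removing it leaves
  a permutation \<open>u\<close> with fewer inversions. Induction along this step yields both a short word
  for \<open>w\<close> and a Bruhat chain from the identity to \<open>w\<close>.\<close>

lemma ex_descent: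
  assumes w: "w permutes {1..n}" and "w \<noteq> id"
  shows "\<exists>k u. 1 \<le> k \<and> k < n \<and> w = u \<circ> transpose k (Suc k) \<and> u k < u (Suc k) \<and>
           u permutes {1..n} \<and> card (inversions n u) < card (inversions n w)"
proof -
  obtain k where k: "1 \<le> k" "k < n" "\<not> w k < w (Suc k)"
    using permutes_increasing_eq_id assms by blast
  define u where "u = w \<circ> transpose k (Suc k)"
  have wu: "w = u \<circ> transpose k (Suc k)" by (simp add: u_def comp_assoc)
  have "w (Suc k) \<noteq> w k"
    using injD [OF permutes_inj [OF w], of "Suc k" k] by auto
  then have uk: "u k < u (Suc k)" using k by (simp add: u_def)
  then have "card (inversions n u) < card (inversions n w)"
    unfolding wu using k by (intro card_inversions_less_transpose) auto
  moreover have "u permutes {1..n}"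
    unfolding u_def using k by (intro permutes_compose [OF permutes_swap_id w]) auto
  ultimately show ?thesis using k wu uk by blast
qed

lemma ex_word_length_le_card_inversions:
  assumes "w permutes {1..n}"
  shows "\<exists>ws. set ws \<subseteq> simple_transpositions n \<and> w = foldr (\<circ>) ws id \<and>
           length ws \<le> card (inversions n w)"
  using assms
proof (induction "card (inversions n w)" arbitrary: w rule: less_induct)
  case less
  show ?case
  proof (cases "w = id")
    case True
    then show ?thesis by (intro exI [of _ "[]"]) simp
  next
    case False
    from ex_descent [OF less.prems this] obtain k u where
      k: "1 \<le> k" "k < n" "w = u \<circ> transpose k (Suc k)"
      and u: "u permutes {1..n}"
      and lt: "card (inversions n u) < card (inversions n w)"
      by blast
    let ?s = "transpose k (Suc k)"
    from less.hyps [OF lt u] obtain ws where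
      ws: "set ws \<subseteq> simple_transpositions n" "u = foldr (\<circ>) ws id"
        "length ws \<le> card (inversions n u)"
      by blast
    have "w = foldr (\<circ>) (ws @ [?s]) id"
      unfolding foldr_comp_snoc using ws(2) k(3) by simp
    moreover have "set (ws @ [?s]) \<subseteq> simple_transpositions n"
      using ws(1) k by (auto simp: simple_transpositions_def)
    ultimately show ?thesis
      using ws(3) lt by (intro exI [of _ "ws @ [?s]"]) simp
  qed
qed

theorem coxeter_length_eq_card_inversions:
  assumes "w permutes {1..n}"
  shows "coxeter_length n w = card (inversions n w)"
proof -
  let ?P = "\<lambda>k. \<exists>ws. length ws = k \<and> set ws \<subseteq> simple_transpositions n \<and> w = foldr (\<circ>) ws id"
  obtain ws where ws: "set ws \<subseteq> simple_transpositions n" "w = foldr (\<circ>) ws id"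
      "length ws \<le> card (inversions n w)"
    using ex_word_length_le_card_inversions [OF assms] by blast
  then have P: "?P (length ws)" by blast
  have "coxeter_length n w \<le> length ws"
    unfolding coxeter_length_def using P by (rule Least_le)
  moreover have "?P (coxeter_length n w)"
    unfolding coxeter_length_def using P by (rule LeastI)
  then have "card (inversions n w) \<le> coxeter_length n w"
    using card_inversions_word_le by metis
  ultimately show ?thesis using ws(3) by linarith
qed

lemma coxeter_length_less_transpose_iff:
  assumes w: "w permutes {1..n}" and ij: "1 \<le> i" "i < j" "j \<le> n"
  shows "coxeter_length n w < coxeter_length n (w \<circ> transpose i j) \<longleftrightarrow> w i < w j"
proof -
  let ?v = "w \<circ> transpose i j"
  have v: "?v permutes {1..n}"
    using ij by (intro permutes_compose [OF permutes_swap_id w]) auto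
  have "w i \<noteq> w j"
    using injD [OF permutes_inj [OF w], of i j] ij by auto
  moreover have "card (inversions n w) < card (inversions n ?v)" if "w i < w j"
    using card_inversions_less_transpose [OF ij that] .
  moreover have "card (inversions n ?v) < card (inversions n w)" if "w j < w i"
    using card_inversions_less_transpose [OF ij, of ?v] that by (simp add: comp_assoc)
  ultimately show ?thesis
    unfolding coxeter_length_eq_card_inversions [OF w] coxeter_length_eq_card_inversions [OF v]
    by (meson linorder_neqE_nat order_less_asym)
qed

lemma bruhat_step_iff:
  "bruhat_step n u v \<longleftrightarrow> u permutes {1..n} \<and>
     (\<exists>i j. 1 \<le> i \<and> i < j \<and> j \<le> n \<and> u i < u j \<and> v = u \<circ> transpose i j)"
  unfolding bruhat_step_def using coxeter_length_less_transpose_iff by blast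

lemma bruhat_step_permutes:
  assumes "bruhat_step n u v"
  shows "v permutes {1..n}"
  using assms unfolding bruhat_step_iff
  by (auto intro!: permutes_compose [OF permutes_swap_id])

lemma bruhat_le_permutes:
  assumes "bruhat_le n u v" "u permutes {1..n}"
  shows "v permutes {1..n}"
  using assms unfolding bruhat_le_def
  by (induction rule: rtranclp_induct) (auto dest: bruhat_step_permutes)

lemma bruhat_le_id:
  assumes "w permutes {1..n}"
  shows "bruhat_le n id w"
  using assms
proof (induction "card (inversions n w)" arbitrary: w rule: less_induct)
  case less
  show ?case
  proof (cases "w = id")
    case True
    then show ?thesis by (simp add: bruhat_le_def)
  next
    case False
    from ex_descent [OF less.prems this] obtain k u where
      k: "1 \<le> k" "k < n" "w = u \<circ> transpose k (Suc k)" "u k < u (Suc k)"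
      and u: "u permutes {1..n}"
      and lt: "card (inversions n u) < card (inversions n w)"
      by blast
    have "bruhat_step n u w"
      unfolding bruhat_step_iff using u k
      by (intro conjI exI [of _ k] exI [of _ "Suc k"]) auto
    with less.hyps [OF lt u] show ?thesis
      unfolding bruhat_le_def by (auto intro: rtranclp.rtrancl_into_rtrancl)
  qed
qed

section \<open>Elementary operations on symmetric multisegments\<close>

lemma is_segment_eq:
  assumes "is_segment D"
  shows "D = {seg_begin D..seg_end D}"
proof -
  obtain i j where ij: "i \<le> j" "D = {i..j}"
    using assms by (auto simp: is_segment_def)
  then have "Min D = i" "Max D = j"
    by (auto intro: Min_eqI Max_eqI)
  with ij(2) show ?thesis by (simp add: seg_begin_def seg_end_def)
qed

text \<open>Linkedness for intervals that both contain a common point.\<close>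

lemma linked_overlapping_iff:
  fixes p q r s :: int
  assumes "p \<le> q" "r \<le> s" "p \<le> s" "r \<le> q"
  shows "linked {p..q} {r..s} \<longleftrightarrow> (p < r \<and> q < s) \<or> (r < p \<and> s < q)"
proof -
  have "{p..q} \<union> {r..s} = {min p r..max q s}" using assms by auto
  moreover have "min p r \<le> max q s" using assms by simp
  ultimately have "is_segment ({p..q} \<union> {r..s})" by (auto simp: is_segment_def)
  moreover have "is_segment {p..q}" "is_segment {r..s}"
    using assms by (auto simp: is_segment_def)
  ultimately show ?thesis using assms by (auto simp: linked_def)
qed

text \<open>The data of a symmetric multisegment whose beginnings and ends are listed in increasing
  order. Only the beginnings and ends of the segments enter.\<close>

locale symmetric_family =
  fixes n :: nat and \<Delta> :: "nat \<Rightarrow> int set"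
  assumes begin_mono: "strict_mono_on {1..n} (\<lambda>i. seg_begin (\<Delta> i))"
    and end_mono: "strict_mono_on {1..n} (\<lambda>i. seg_end (\<Delta> i))"
    and begin_le_end: "\<And>i j. i \<in> {1..n} \<Longrightarrow> j \<in> {1..n} \<Longrightarrow> seg_begin (\<Delta> i) \<le> seg_end (\<Delta> j)"
begin

abbreviation b :: "nat \<Rightarrow> int" where "b i \<equiv> seg_begin (\<Delta> i)"
abbreviation e :: "nat \<Rightarrow> int" where "e i \<equiv> seg_end (\<Delta> i)"

lemma b_less_iff: "i \<in> {1..n} \<Longrightarrow> j \<in> {1..n} \<Longrightarrow> b i < b j \<longleftrightarrow> i < j"
  using strict_mono_on_less [OF begin_mono] by blast

lemma e_less_iff: "i \<in> {1..n} \<Longrightarrow> j \<in> {1..n} \<Longrightarrow> e i < e j \<longleftrightarrow> i < j"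
  using strict_mono_on_less [OF end_mono] by blast

lemma set_Phi: "set_mset (Phi n \<Delta> w) = (\<lambda>i. {b i..e (w i)}) ` {1..n}"
  by (auto simp: Phi_def set_mset_sum)

lemma inj_on_Phi: "inj_on (Phi n \<Delta>) {w. w permutes {1..n}}"
proof (rule inj_onI, clarify)
  fix w v assume w: "w permutes {1..n}" and v: "v permutes {1..n}"
    and eq: "Phi n \<Delta> w = Phi n \<Delta> v"
  show "w = v"
  proof
    fix i
    show "w i = v i"
    proof (cases "i \<in> {1..n}")
      case True
      then have "{b i..e (w i)} \<in># Phi n \<Delta> v"
        unfolding eq [symmetric] set_Phi by (rule imageI)
      then obtain k where k: "k \<in> {1..n}" "{b i..e (w i)} = {b k..e (v k)}"
        by (auto simp: set_Phi)
      have range: "w i \<in> {1..n}" "v k \<in> {1..n}"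
        using True k(1) permutes_in_image [OF w] permutes_in_image [OF v] by blast+
      then have "b i = b k" "e (w i) = e (v k)"
        using k begin_le_end True by (simp_all add: Icc_eq_Icc)
      then have "i = k" "w i = v k"
        using True k(1) range b_less_iff e_less_iff by (metis linorder_neq_iff)+
      then show ?thesis by simp
    next
      case False
      then show ?thesis using permutes_not_in [OF w] permutes_not_in [OF v] by metis
    qed
  qed
qed

lemma Phi_split:
  assumes "i \<in> {1..n}" "j \<in> {1..n}" "i \<noteq> j"
  shows "Phi n \<Delta> w = {#{b i..e (w i)}, {b j..e (w j)}#} +
           (\<Sum>k\<in>{1..n} - {i, j}. {#{b k..e (w k)}#})"
proof -
  have "{1..n} - {i, j} = {1..n} - {i} - {j}" by auto
  then show ?thesis
    unfolding Phi_def using assms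
      sum.remove [of "{1..n}" i "\<lambda>k. {#{b k..e (w k)}#}"]
      sum.remove [of "{1..n} - {i}" j "\<lambda>k. {#{b k..e (w k)}#}"]
    by simp
qed

text \<open>The effect of the operation on a linked pair: since the intersection is nonempty, nothing
  is discarded and the two ends are exchanged.\<close>

lemma Phi_transpose:
  assumes w: "w permutes {1..n}" and ij: "i \<in> {1..n}" "j \<in> {1..n}" "i < j" and lt: "w i < w j"
  defines "D \<equiv> {b i..e (w i)}" and "D' \<equiv> {b j..e (w j)}"
  shows "Phi n \<Delta> (w \<circ> transpose i j) =
    (Phi n \<Delta> w - {#D, D'#}) + filter_mset (\<lambda>E. E \<noteq> {}) {#D \<union> D', D \<inter> D'#}"
proof -
  have range: "w i \<in> {1..n}" "w j \<in> {1..n}"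
    using ij permutes_in_image [OF w] by blast+
  have less: "b i < b j" "e (w i) < e (w j)"
    using ij range lt b_less_iff e_less_iff by blast+
  have le: "b i \<le> e (w i)" "b i \<le> e (w j)" "b j \<le> e (w i)" "b j \<le> e (w j)"
    using ij range begin_le_end by blast+
  have "D \<union> D' = {b i..e (w j)}" "D \<inter> D' = {b j..e (w i)}"
    unfolding D_def D'_def using less le by auto
  then have "filter_mset (\<lambda>E. E \<noteq> {}) {#D \<union> D', D \<inter> D'#} = {#{b i..e (w j)}, {b j..e (w i)}#}"
    using le by simp
  moreover have "Phi n \<Delta> w - {#D, D'#} = (\<Sum>k\<in>{1..n} - {i, j}. {#{b k..e (w k)}#})"
    using Phi_split [of i j w] ij unfolding D_def D'_def by simp
  moreover have "Phi n \<Delta> (w \<circ> transpose i j) =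
      {#{b i..e (w j)}, {b j..e (w i)}#} + (\<Sum>k\<in>{1..n} - {i, j}. {#{b k..e (w k)}#})"
  proof -
    have "(\<Sum>k\<in>{1..n} - {i, j}. {#{b k..e ((w \<circ> transpose i j) k)}#}) =
        (\<Sum>k\<in>{1..n} - {i, j}. {#{b k..e (w k)}#})"
      by (rule sum.cong) (auto simp: transpose_def)
    then show ?thesis
      using Phi_split [of i j "w \<circ> transpose i j"] ij by simp
  qed
  ultimately show ?thesis by simp
qed

lemma elementary_op_Phi_iff:
  assumes w: "w permutes {1..n}"
  shows "elementary_op (Phi n \<Delta> w) x \<longleftrightarrow> (\<exists>v. bruhat_step n w v \<and> x = Phi n \<Delta> v)"
proof
  let ?seg = "\<lambda>i. {b i..e (w i)}"
  let ?result = "\<lambda>D D'. (Phi n \<Delta> w - {#D, D'#}) +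
    filter_mset (\<lambda>E. E \<noteq> {}) {#D \<union> D', D \<inter> D'#}"
  have linked_iff: "linked (?seg i) (?seg j) \<longleftrightarrow> (i < j \<and> w i < w j) \<or> (j < i \<and> w j < w i)"
    if "i \<in> {1..n}" "j \<in> {1..n}" for i j
  proof -
    have range: "w i \<in> {1..n}" "w j \<in> {1..n}"
      using that permutes_in_image [OF w] by blast+
    show ?thesis
      using that range
      by (subst linked_overlapping_iff) (simp_all add: begin_le_end b_less_iff e_less_iff)
  qed
  {
    assume "elementary_op (Phi n \<Delta> w) x"
    then obtain D D' where D: "{#D, D'#} \<subseteq># Phi n \<Delta> w" "linked D D'" and x: "x = ?result D D'"
      unfolding elementary_op_def by blast
    from D(1) have "D \<in># Phi n \<Delta> w" "D' \<in># Phi n \<Delta> w"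
      by (auto dest: mset_subset_eqD)
    then obtain i j where ij: "i \<in> {1..n}" "j \<in> {1..n}" "D = ?seg i" "D' = ?seg j"
      unfolding set_Phi by blast
    have "\<exists>i j. i \<in> {1..n} \<and> j \<in> {1..n} \<and> i < j \<and> w i < w j \<and> x = ?result (?seg i) (?seg j)"
    proof -
      from D(2) ij linked_iff consider "i < j" "w i < w j" | "j < i" "w j < w i" by blast
      then show ?thesis
      proof cases
        case 1
        then show ?thesis using ij x by blast
      next
        case 2
        moreover have "?result D D' = ?result D' D"
          by (simp only: Un_commute [of D] Int_commute [of D] add_mset_commute [of D])
        ultimately show ?thesis using ij x by blast
      qed
    qed
    then obtain i j where ij: "i \<in> {1..n}" "j \<in> {1..n}" "i < j" "w i < w j"
      and x: "x = ?result (?seg i) (?seg j)"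
      by blast
    have "x = Phi n \<Delta> (w \<circ> transpose i j)"
      unfolding x by (rule Phi_transpose [OF w ij, symmetric])
    moreover have "bruhat_step n w (w \<circ> transpose i j)"
      using w ij unfolding bruhat_step_iff atLeastAtMost_iff by blast
    ultimately show "\<exists>v. bruhat_step n w v \<and> x = Phi n \<Delta> v" by blast
  next
    assume "\<exists>v. bruhat_step n w v \<and> x = Phi n \<Delta> v"
    then obtain i j where ij: "1 \<le> i" "i < j" "j \<le> n" "w i < w j"
      and x: "x = Phi n \<Delta> (w \<circ> transpose i j)"
      unfolding bruhat_step_iff by blast
    then have ij': "i \<in> {1..n}" "j \<in> {1..n}" by auto
    have "{#?seg i, ?seg j#} \<subseteq># Phi n \<Delta> w"
      using Phi_split [of i j w] ij' ij(2) by simp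
    moreover have "linked (?seg i) (?seg j)"
      using linked_iff ij' ij(2,4) by blast
    ultimately show "elementary_op (Phi n \<Delta> w) x"
      unfolding elementary_op_def x using Phi_transpose [OF w ij' ij(2,4)] by blast
  }
qed

lemma mseg_le_Phi_iff:
  assumes w: "w permutes {1..n}"
  shows "mseg_le x (Phi n \<Delta> w) \<longleftrightarrow> (\<exists>v. bruhat_le n w v \<and> x = Phi n \<Delta> v)"
proof
  assume "mseg_le x (Phi n \<Delta> w)"
  then have "elementary_op\<^sup>*\<^sup>* (Phi n \<Delta> w) x" by (simp add: mseg_le_def)
  then show "\<exists>v. bruhat_le n w v \<and> x = Phi n \<Delta> v"
  proof (induction rule: rtranclp_induct)
    case base
    then show ?case by (auto simp: bruhat_le_def)
  next
    case (step y z)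
    then obtain v where v: "bruhat_le n w v" "y = Phi n \<Delta> v" by blast
    then show ?case
      using step.hyps(2) elementary_op_Phi_iff [OF bruhat_le_permutes [OF v(1) w]]
      unfolding bruhat_le_def by (metis rtranclp.rtrancl_into_rtrancl)
  qed
next
  assume "\<exists>v. bruhat_le n w v \<and> x = Phi n \<Delta> v"
  then obtain v where v: "(bruhat_step n)\<^sup>*\<^sup>* w v" "x = Phi n \<Delta> v"
    by (auto simp: bruhat_le_def)
  from v(1) have "elementary_op\<^sup>*\<^sup>* (Phi n \<Delta> w) (Phi n \<Delta> v)"
  proof (induction rule: rtranclp_induct)
    case base
    then show ?case by simp
  next
    case (step y z)
    then have "y permutes {1..n}" by (simp add: bruhat_step_def)
    then have "elementary_op (Phi n \<Delta> y) (Phi n \<Delta> z)"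
      using step.hyps(2) elementary_op_Phi_iff by blast
    with step.IH show ?case by (rule rtranclp.rtrancl_into_rtrancl)
  qed
  then show "mseg_le x (Phi n \<Delta> w)" by (simp add: mseg_le_def v(2))
qed

lemma bij_betw_Phi: "bij_betw (Phi n \<Delta>) {w. w permutes {1..n}} (mseg_below (Phi n \<Delta> id))"
proof -
  have "mseg_below (Phi n \<Delta> id) = Phi n \<Delta> ` {w. bruhat_le n id w}"
    unfolding mseg_below_def mseg_le_Phi_iff [OF permutes_id] by blast
  also have "{w. bruhat_le n id w} = {w. w permutes {1..n}}"
    using bruhat_le_id bruhat_le_permutes [OF _ permutes_id] by blast
  finally show ?thesis unfolding bij_betw_def using inj_on_Phi by blast
qed

lemma bruhat_le_iff_mseg_le:
  assumes w: "w permutes {1..n}" and v: "v permutes {1..n}"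
  shows "bruhat_le n w v \<longleftrightarrow> mseg_le (Phi n \<Delta> v) (Phi n \<Delta> w)"
proof
  assume "mseg_le (Phi n \<Delta> v) (Phi n \<Delta> w)"
  then obtain u where u: "bruhat_le n w u" "Phi n \<Delta> v = Phi n \<Delta> u"
    using mseg_le_Phi_iff [OF w] by blast
  then have "v = u"
    using inj_onD [OF inj_on_Phi] v bruhat_le_permutes [OF u(1) w] by blast
  with u(1) show "bruhat_le n w v" by simp
qed (use mseg_le_Phi_iff [OF w] in blast)

end

section \<open>The parametrization of a symmetric multisegment\<close>

theorem proposition2p1p8:
  fixes n :: nat and \<Delta> :: "nat \<Rightarrow> int set" and a_Id :: "int set multiset"
  assumes "a_Id = (\<Sum>i=1..n. {# \<Delta> i #})"
    and "symmetric a_Id"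
    and "strict_mono_on {1..n} (\<lambda>i. seg_begin (\<Delta> i))"
    and "strict_mono_on {1..n} (\<lambda>i. seg_end (\<Delta> i))"
  shows "bij_betw (Phi n \<Delta>) {w. w permutes {1..n}} (mseg_below a_Id) \<and>
    (\<forall>w v. w permutes {1..n} \<longrightarrow> v permutes {1..n} \<longrightarrow>
       (bruhat_le n w v \<longleftrightarrow> mseg_le (Phi n \<Delta> v) (Phi n \<Delta> w)))"
proof -
  have set_a: "set_mset a_Id = \<Delta> ` {1..n}"
    unfolding assms(1) by (auto simp: set_mset_sum)
  interpret symmetric_family n \<Delta>
  proof
    fix i j assume ij: "i \<in> {1..n}" "j \<in> {1..n}"
    have "seg_begin (\<Delta> i) \<le> Max (seg_begin ` set_mset a_Id)"
      using ij by (intro Max_ge) (auto simp: set_a)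
    also have "\<dots> \<le> Min (seg_end ` set_mset a_Id)"
      using assms(2) by (simp add: symmetric_def)
    also have "\<dots> \<le> seg_end (\<Delta> j)"
      using ij by (intro Min_le) (auto simp: set_a)
    finally show "seg_begin (\<Delta> i) \<le> seg_end (\<Delta> j)" .
  qed (use assms(3,4) in blast)+
  have "\<Delta> i = {seg_begin (\<Delta> i)..seg_end (\<Delta> i)}" if "i \<in> {1..n}" for i
    using assms(2) that set_a
    by (intro is_segment_eq) (auto simp: symmetric_def ordinary_def multisegment_def)
  then have "a_Id = Phi n \<Delta> id"
    unfolding assms(1) Phi_def by (intro sum.cong) auto
  then show ?thesis using bij_betw_Phi bruhat_le_iff_mseg_le by blast
qed

end
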